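(* Let $X$ be a non-empty set, let $\tau$ be the discrete topology on $X$, and let $G_\tau$ be the discrete topological graph of $X$. Then $G_\tau$ has no isolated vertex.
   Context: For a non-empty set $X$ with the discrete topology $\tau$ (so $\tau$ is the family of all subsets of $X$), the discrete topological graph $G_\tau=(V,E)$ is the simple undirected graph with vertex set $V=\{A\in\tau : A\neq\emptyset,\ A\neq X\}$ in which two vertices $A,B$ are adjacent if and only if $A\cap B=\emptyset$. An isolated vertex is a vertex of degree $0$. *)

theory Defs
  imports "HOL-Analysis.Analysis"
begin

record 'v ugraph =
  vertices :: "'v set"
  edges :: "'v set set"

definition simple_graph :: "'v ugraph \<Rightarrow> bool" where
  "simple_graph G \<longleftrightarrow> (\<forall>e\<in>edges G. e \<subseteq> vertices G \<and> card e = 2)"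

definition adjacent :: "'v ugraph \<Rightarrow> 'v \<Rightarrow> 'v \<Rightarrow> bool" where
  "adjacent G u v \<longleftrightarrow> {u, v} \<in> edges G"

text \<open>The degree takes values in \<^typ>\<open>enat\<close>: the graphs may be infinite, and the cardinality
  \<^const>\<open>card\<close> of an infinite set is 0, which would turn vertices of infinite degree into
  isolated ones.\<close>

definition graph_degree :: "'v ugraph \<Rightarrow> 'v \<Rightarrow> enat" where
  "graph_degree G v =
     (if finite {w \<in> vertices G. adjacent G v w}
      then enat (card {w \<in> vertices G. adjacent G v w}) else \<infinity>)"

definition isolated_vertex :: "'v ugraph \<Rightarrow> 'v \<Rightarrow> bool" where
  "isolated_vertex G v \<longleftrightarrow> v \<in> vertices G \<and> graph_degree G v = 0"

definition discrete_topological_graph :: "'a set \<Rightarrow> 'a set ugraph" where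
  "discrete_topological_graph X =
     (let V = {A. openin (discrete_topology X) A \<and> A \<noteq> {} \<and> A \<noteq> X}
      in \<lparr>vertices = V, edges = {{A, B} | A B. A \<in> V \<and> B \<in> V \<and> A \<inter> B = {}}\<rparr>)"

lemma simple_discrete_topological_graph: "simple_graph (discrete_topological_graph X)"
proof -
  have "card {A, B} = 2" if "A \<noteq> {}" "A \<inter> B = {}" for A B :: "'a set"
    using that by (cases "A = B") auto
  then show ?thesis
    by (auto simp: simple_graph_def discrete_topological_graph_def Let_def)
qed

lemma adjacent_discrete_topological_graph:
  assumes "A \<in> vertices (discrete_topological_graph X)"
    and "B \<in> vertices (discrete_topological_graph X)"
  shows "adjacent (discrete_topological_graph X) A B \<longleftrightarrow> A \<inter> B = {}"
  using assms
  by (auto simp: adjacent_def discrete_topological_graph_def Let_def doubleton_eq_iff)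

end

theory Submission
  imports Defs
begin

text \<open>Every vertex is adjacent to its complement in \<open>X\<close>: discreteness makes the complement
  open, and a proper non-empty subset has a proper non-empty complement.\<close>

text \<open>An infinite neighbourhood has degree \<open>\<infinity>\<close> rather than the value 0 that \<^const>\<open>card\<close>
  assigns to it, so a single neighbour already rules out degree 0.\<close>

lemma not_isolated_vertex_if_adjacent:
  assumes "w \<in> vertices G" "adjacent G v w"
  shows "\<not> isolated_vertex G v"
  using assms by (auto simp: isolated_vertex_def graph_degree_def zero_enat_def)

lemma complement_in_vertices:
  assumes "A \<in> vertices (discrete_topological_graph X)"
  shows "X - A \<in> vertices (discrete_topological_graph X)"
  using assms by (auto simp: discrete_topological_graph_def)

theorem proposition2p10:
  fixes X :: "'a set"
  assumes "X \<noteq> {}"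
  shows "\<not> (\<exists>A. isolated_vertex (discrete_topological_graph X) A)"
proof
  assume "\<exists>A. isolated_vertex (discrete_topological_graph X) A"
  then obtain A where isolated: "isolated_vertex (discrete_topological_graph X) A" ..
  then have A: "A \<in> vertices (discrete_topological_graph X)"
    by (simp add: isolated_vertex_def)
  have "adjacent (discrete_topological_graph X) A (X - A)"
    using A complement_in_vertices[OF A] by (simp add: adjacent_discrete_topological_graph)
  from not_isolated_vertex_if_adjacent[OF complement_in_vertices[OF A] this] isolated
  show False ..
qed

end
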